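(* For every $\eta>0$ there is $b_0$ such that for every integer constant $b\ge b_0$ there is a constant $C$ for which the following holds for every $k\ge 3$. If $k$ stations execute the protocol SublinearDecrease$(b)$, each station switching off as soon as it receives the acknowledgement of its own successful transmission, and are activated by any adaptive adversary, then with probability at least $1-1/k^{\eta}$ every station transmits successfully within $C k\frac{\ln^2 k}{\ln\ln k}$ rounds after its own activation.
   Context: Model. $k$ anonymous identical stations share a channel. Time is divided into discrete synchronous rounds; there is no global clock available to the stations and no collision detection. Initially all stations are asleep. Each station holds one packet and is activated once, at a time chosen by an adversary. The activation round is round $0$ of the station's local clock, and the station may transmit from its local round $1$ on. In each round every active station either transmits or listens. A transmission is successful if and only if exactly one active station transmits in that round; the transmitter then receives an acknowledgement and switches off permanently. In all other cases nothing is received. The stations do not know $k$. An adaptive adversary decides online which station to activate and when, knowing the algorithm's code and the history of the computation but not future randomness; in total it activates $k$ stations. Protocol SublinearDecrease$(b)$ (executed by each station from its activation until it switches off): for $j=3,4,5,\ldots$: for $b$ rounds, transmit in each round with probability $\frac{\ln j}{j}$, independently over rounds and stations. *)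

theory Defs
  imports "HOL-Probability.Probability"
begin

text \<open>
  The stations are \<open>0, \<dots>, k - 1\<close>. A history lists, for the global rounds
  \<open>0, 1, \<dots>, length h - 1\<close> played so far, the set of stations activated in that round and the
  set of stations transmitting in it. This is everything there is to know about the past: in
  particular the adversary is also shown who took part in a collision, although the stations are
  not.
\<close>

type_synonym history = "(nat set \<times> nat set) list"

text \<open>
  An adaptive adversary maps the history of the rounds before the current one to the stations
  to be activated in the current round, possibly several or none.
\<close>

type_synonym adversary = "history \<Rightarrow> nat set"

definition asleep :: "history \<Rightarrow> nat \<Rightarrow> bool" where
  "asleep h i \<longleftrightarrow> (\<forall>s < length h. i \<notin> fst (h ! s))"

definition switched_off :: "history \<Rightarrow> nat \<Rightarrow> bool" where
  "switched_off h i \<longleftrightarrow> (\<exists>s < length h. snd (h ! s) = {i})"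

text \<open>
  Each station is activated at most once: naming a station that is not asleep has no effect.
\<close>

definition newly_activated :: "nat \<Rightarrow> adversary \<Rightarrow> history \<Rightarrow> nat set" where
  "newly_activated k adv h = {i \<in> adv h. i < k \<and> asleep h i}"

text \<open>
  The coin \<open>\<omega> (i, r)\<close> tells whether station \<open>i\<close>, if still active, transmits in its local
  round \<open>r\<close>. A station activated in global round \<open>s\<close> is in local round \<open>length h - s\<close> in the
  current global round \<open>length h\<close>; as \<open>s < length h\<close>, this is at least 1.
\<close>

definition transmitters :: "nat \<Rightarrow> (nat \<times> nat \<Rightarrow> bool) \<Rightarrow> history \<Rightarrow> nat set" where
  "transmitters k \<omega> h =
     {i. i < k \<and> \<not> switched_off h i \<and>
         (\<exists>s < length h. i \<in> fst (h ! s) \<and> \<omega> (i, length h - s))}"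

fun execution :: "nat \<Rightarrow> adversary \<Rightarrow> (nat \<times> nat \<Rightarrow> bool) \<Rightarrow> nat \<Rightarrow> history" where
  "execution k adv \<omega> 0 = []"
| "execution k adv \<omega> (Suc t) =
     (let h = execution k adv \<omega> t in h @ [(newly_activated k adv h, transmitters k \<omega> h)])"

definition activated_at ::
    "nat \<Rightarrow> adversary \<Rightarrow> (nat \<times> nat \<Rightarrow> bool) \<Rightarrow> nat \<Rightarrow> nat \<Rightarrow> bool" where
  "activated_at k adv \<omega> t i \<longleftrightarrow> i \<in> newly_activated k adv (execution k adv \<omega> t)"

definition succeeds_at ::
    "nat \<Rightarrow> adversary \<Rightarrow> (nat \<times> nat \<Rightarrow> bool) \<Rightarrow> nat \<Rightarrow> nat \<Rightarrow> bool" where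
  "succeeds_at k adv \<omega> t i \<longleftrightarrow> transmitters k \<omega> (execution k adv \<omega> t) = {i}"

text \<open>
  Independent coins for \<open>k\<close> identical stations, each of which transmits with probability
  \<open>p r\<close> in its local round \<open>r\<close>.
\<close>

definition coin_space :: "nat \<Rightarrow> (nat \<Rightarrow> real) \<Rightarrow> (nat \<times> nat \<Rightarrow> bool) measure" where
  "coin_space k p =
     PiM ({..<k} \<times> {1..}) (\<lambda>(i, r). measure_pmf (bernoulli_pmf (p r)))"

text \<open>
  The phase \<open>j = 3, 4, \<dots>\<close> consists of the \<open>b\<close> local rounds
  \<open>(j - 3) * b + 1, \<dots>, (j - 2) * b\<close>.
\<close>

definition sublinear_decrease :: "nat \<Rightarrow> nat \<Rightarrow> real" where
  "sublinear_decrease b r = (let j = 3 + (r - 1) div b in ln (real j) / real j)"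

lemma sublinear_decrease_bounds: "0 \<le> sublinear_decrease b r" "sublinear_decrease b r \<le> 1"
proof -
  have "ln (real (3 + (r - 1) div b)) \<le> real (3 + (r - 1) div b)"
    using ln_le_minus_one[of "real (3 + (r - 1) div b)"] by simp
  then show "0 \<le> sublinear_decrease b r" "sublinear_decrease b r \<le> 1"
    by (simp_all add: sublinear_decrease_def Let_def)
qed

end

theory Submission
  imports Defs "HOL-Real_Asymp.Real_Asymp"
begin

text \<open>
  Call the load of a round the sum of the transmission probabilities of the active stations.
  Fix a station and the window of its first \<open>T\<close> local rounds. Since the probabilities decrease,
  the loads in the window sum to at most \<open>k * (p 1 + \<dots> + p T) = O(k (ln k)\<^sup>2)\<close>, so at least half
  of the rounds have load at most \<open>1 + ln (ln k) / 4\<close>. In such a round, either the load is at most 1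
  and the fixed station succeeds with probability at least \<open>p T / e\<^sup>2\<close>, or the load exceeds 1 and
  some station succeeds with probability of order at least \<open>1 / sqrt (ln k)\<close>. As there are at most
  \<open>k\<close> successes altogether, both kinds of rounds make it unlikely that the fixed station fails.
  An exponential supermartingale that charges each success of another station \<open>1 / k\<close> in the
  exponent accounts for both at once, and it is insensitive to the adaptivity of the adversary.
\<close>

section \<open>Executions\<close>

lemma length_execution [simp]: "length (execution k adv \<omega> t) = t"
  by (induction t) (auto simp: Let_def)

lemma take_execution: "u \<le> t \<Longrightarrow> take u (execution k adv \<omega> t) = execution k adv \<omega> u"
proof (induction t)
  case (Suc t)
  then show ?case
    by (cases "u = Suc t") (auto simp: Let_def)
qed simp

lemma nth_execution:
  assumes "u < t"
  shows "execution k adv \<omega> t ! u =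
    (newly_activated k adv (execution k adv \<omega> u), transmitters k \<omega> (execution k adv \<omega> u))"
proof -
  have "execution k adv \<omega> t ! u = take (Suc u) (execution k adv \<omega> t) ! u"
    by simp
  also have "take (Suc u) (execution k adv \<omega> t) = execution k adv \<omega> (Suc u)"
    using assms by (intro take_execution) simp
  finally show ?thesis
    by (simp add: Let_def nth_append)
qed

lemma activated_at_unique:
  assumes "activated_at k adv \<omega> s i" "activated_at k adv \<omega> s' i"
  shows "s = s'"
proof -
  have "False" if "a < b" "activated_at k adv \<omega> a i" "activated_at k adv \<omega> b i" for a b
  proof -
    have "i \<in> fst (execution k adv \<omega> b ! a)"
      using that by (simp add: nth_execution activated_at_def)
    then have "\<not> asleep (execution k adv \<omega> b) i"
      using that by (auto simp: asleep_def)
    then show False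
      using that by (simp add: activated_at_def newly_activated_def)
  qed
  then show ?thesis
    using assms by (meson linorder_neqE_nat)
qed

lemma transmitters_subset: "transmitters k \<omega> h \<subseteq> {..<k}"
  by (auto simp: transmitters_def)

lemma succeeds_at_unique:
  assumes "succeeds_at k adv \<omega> s i" "succeeds_at k adv \<omega> s' i"
  shows "s = s'"
proof -
  have "False" if "a < b" "succeeds_at k adv \<omega> a i" "succeeds_at k adv \<omega> b i" for a b
  proof -
    have "switched_off (execution k adv \<omega> b) i"
      using that by (auto simp: switched_off_def nth_execution succeeds_at_def)
    then have "i \<notin> transmitters k \<omega> (execution k adv \<omega> b)"
      by (auto simp: transmitters_def)
    then show False
      using that by (auto simp: succeeds_at_def)
  qed
  then show ?thesis
    using assms by (meson linorder_neqE_nat)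
qed

section \<open>Activity and age as functions of the history\<close>

definition active :: "nat \<Rightarrow> history \<Rightarrow> nat set" where
  "active k h = {i. i < k \<and> \<not> switched_off h i \<and> \<not> asleep h i}"

text \<open>In an execution the activation round is unique, so \<open>LEAST\<close> only serves to
  pick it out. Reading the age off the history alone lets every later quantity be a function of the
  history. For a station that is still asleep the value is arbitrary.\<close>

definition age :: "history \<Rightarrow> nat \<Rightarrow> nat" where
  "age h i = length h - (LEAST s. s < length h \<and> i \<in> fst (h ! s))"

lemma finite_active [simp]: "finite (active k h)"
  by (simp add: active_def)

lemma mem_fst_execution_iff:
  "s < t \<Longrightarrow> i \<in> fst (execution k adv \<omega> t ! s) \<longleftrightarrow> activated_at k adv \<omega> s i"
  by (simp add: nth_execution activated_at_def)

lemma age_execution: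
  assumes "activated_at k adv \<omega> s i" "s < t"
  shows "age (execution k adv \<omega> t) i = t - s"
proof -
  have "(LEAST s. s < t \<and> i \<in> fst (execution k adv \<omega> t ! s)) = s"
  proof (rule Least_equality)
    show "s < t \<and> i \<in> fst (execution k adv \<omega> t ! s)"
      using assms by (simp add: mem_fst_execution_iff)
    fix y assume "y < t \<and> i \<in> fst (execution k adv \<omega> t ! y)"
    then have "activated_at k adv \<omega> y i"
      by (auto simp: mem_fst_execution_iff)
    then show "s \<le> y"
      using activated_at_unique assms(1) by blast
  qed
  then show ?thesis
    by (simp add: age_def)
qed

lemma active_execution:
  "i \<in> active k (execution k adv \<omega> t) \<longleftrightarrow>
    (\<exists>s<t. activated_at k adv \<omega> s i) \<and> (\<forall>s<t. \<not> succeeds_at k adv \<omega> s i)"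
proof -
  have "switched_off (execution k adv \<omega> t) i \<longleftrightarrow> (\<exists>s<t. succeeds_at k adv \<omega> s i)"
    by (simp add: switched_off_def nth_execution succeeds_at_def cong: conj_cong)
  moreover have "asleep (execution k adv \<omega> t) i \<longleftrightarrow> (\<forall>s<t. \<not> activated_at k adv \<omega> s i)"
    by (simp add: asleep_def mem_fst_execution_iff)
  moreover have "i < k" if "activated_at k adv \<omega> s i" for s
    using that by (simp add: activated_at_def newly_activated_def)
  ultimately show ?thesis
    by (auto simp: active_def)
qed

lemma age_active_execution:
  assumes "i \<in> active k (execution k adv \<omega> t)"
  shows "1 \<le> age (execution k adv \<omega> t) i"
  using assms by (auto simp: active_execution age_execution)

text \<open>The coins \<open>\<omega>'\<close> need not be those that produced the history. This
  freedom is what allows two assignments of the coins to be compared after a common past.\<close>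

lemma transmitters_execution:
  "transmitters k \<omega>' (execution k adv \<omega> t) =
    {i \<in> active k (execution k adv \<omega> t). \<omega>' (i, age (execution k adv \<omega> t) i)}"
    (is "transmitters k \<omega>' ?h = _")
proof -
  have "(\<exists>s<length ?h. i \<in> fst (?h ! s) \<and> \<omega>' (i, length ?h - s)) \<longleftrightarrow>
      \<not> asleep ?h i \<and> \<omega>' (i, age ?h i)" for i
    unfolding asleep_def using age_execution[of k adv \<omega> _ i t]
    by (auto simp: mem_fst_execution_iff)
  then show ?thesis
    by (auto simp: transmitters_def active_def)
qed

definition new_coins :: "nat \<Rightarrow> history \<Rightarrow> (nat \<times> nat) set" where
  "new_coins k h = (\<lambda>i. (i, age h i)) ` active k h"

text \<open>While \<open>new_coins k h\<close> are the coins that decide the round following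
  \<open>h\<close>, these are the ones read while \<open>h\<close> was produced. They can be
  recovered from the prefixes of \<open>h\<close>.\<close>

definition revealed_coins :: "nat \<Rightarrow> history \<Rightarrow> (nat \<times> nat) set" where
  "revealed_coins k h = (\<Union>u<length h. new_coins k (take u h))"

lemma finite_new_coins [simp]: "finite (new_coins k h)"
  by (simp add: new_coins_def)

lemma finite_revealed_coins [simp]: "finite (revealed_coins k h)"
  by (simp add: revealed_coins_def)

lemma revealed_coins_snoc: "revealed_coins k (h @ [z]) = revealed_coins k h \<union> new_coins k h"
  by (simp add: revealed_coins_def lessThan_Suc Un_commute)

lemma revealed_coins_execution:
  "revealed_coins k (execution k adv \<omega> t) = (\<Union>u<t. new_coins k (execution k adv \<omega> u))"
  by (simp add: revealed_coins_def take_execution)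

lemma revealed_coins_subset:
  "revealed_coins k (execution k adv \<omega> t) \<subseteq> {..<k} \<times> {1..}"
proof -
  have "new_coins k (execution k adv \<omega> u) \<subseteq> {..<k} \<times> {1..}" for u
    using age_active_execution[of _ k adv \<omega> u] by (auto simp: new_coins_def active_def)
  then show ?thesis
    unfolding revealed_coins_execution by blast
qed

text \<open>The age of a station grows in every round, so no coin is read twice. This is the source
  of the independence of the next round from the past.\<close>

lemma new_coins_disjoint:
  "revealed_coins k (execution k adv \<omega> t) \<inter> new_coins k (execution k adv \<omega> t) = {}"
proof -
  have "age (execution k adv \<omega> u) i \<noteq> age (execution k adv \<omega> t) i"
    if "i \<in> active k (execution k adv \<omega> u)" "u < t" for i u
  proof -
    obtain s where "s < u" "activated_at k adv \<omega> s i"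
      using \<open>i \<in> active k (execution k adv \<omega> u)\<close> by (auto simp: active_execution)
    then show ?thesis
      using \<open>u < t\<close> by (simp add: age_execution)
  qed
  then show ?thesis
    by (fastforce simp: revealed_coins_execution new_coins_def)
qed

lemma transmitters_eq_iff:
  "transmitters k \<omega>' (execution k adv \<omega> t) = transmitters k \<omega> (execution k adv \<omega> t) \<longleftrightarrow>
    (\<forall>c \<in> new_coins k (execution k adv \<omega> t). \<omega>' c = \<omega> c)"
proof -
  have "{i \<in> A. \<omega>' (i, f i)} = {i \<in> A. \<omega> (i, f i)} \<longleftrightarrow>
      (\<forall>c \<in> (\<lambda>i. (i, f i)) ` A. \<omega>' c = \<omega> c)" (is "?X = ?Y \<longleftrightarrow> ?R")
    for A and f :: "nat \<Rightarrow> nat"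
  proof
    assume eq: "?X = ?Y"
    have "\<omega>' (i, f i) = \<omega> (i, f i)" if "i \<in> A" for i
    proof -
      have "i \<in> ?X \<longleftrightarrow> i \<in> ?Y"
        by (simp only: eq)
      then show ?thesis
        using that by simp
    qed
    then show ?R
      by simp
  next
    assume ?R
    then show "?X = ?Y"
      by (intro Collect_cong conj_cong refl) simp
  qed
  then show ?thesis
    by (simp only: transmitters_execution new_coins_def)
qed

text \<open>The adversary sees only the history, so a history and the coins read in producing it
  determine each other. Hence the occurrence of a given history is a cylinder event, even though the
  adversary is adaptive.\<close>

lemma execution_eq_iff:
  "execution k adv \<omega>' t = execution k adv \<omega> t \<longleftrightarrow>
    (\<forall>c \<in> revealed_coins k (execution k adv \<omega> t). \<omega>' c = \<omega> c)"
proof (induction t)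
  case (Suc t)
  have snoc: "h' @ [(g h', f' h')] = h @ [(g h, f h)] \<longleftrightarrow> h' = h \<and> f' h = f h"
    for h h' :: history and g f f'
    by auto
  have "execution k adv \<omega>' (Suc t) = execution k adv \<omega> (Suc t) \<longleftrightarrow>
      execution k adv \<omega>' t = execution k adv \<omega> t \<and>
      transmitters k \<omega>' (execution k adv \<omega> t) = transmitters k \<omega> (execution k adv \<omega> t)"
    unfolding execution.simps Let_def by (rule snoc)
  also have "\<dots> \<longleftrightarrow> (\<forall>c \<in> revealed_coins k (execution k adv \<omega> t) \<union>
      new_coins k (execution k adv \<omega> t). \<omega>' c = \<omega> c)"
    by (simp only: Suc transmitters_eq_iff ball_Un)
  also have "revealed_coins k (execution k adv \<omega> t) \<union> new_coins k (execution k adv \<omega> t) =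
      revealed_coins k (execution k adv \<omega> (Suc t))"
    by (simp add: Let_def revealed_coins_snoc)
  finally show ?case .
qed (simp add: revealed_coins_def)

text \<open>Expectations over the histories of a fixed length thereby become finite sums.\<close>

lemma finite_range_execution: "finite (range (\<lambda>\<omega>. execution k adv \<omega> t))"
proof (rule finite_subset)
  show "range (\<lambda>\<omega>. execution k adv \<omega> t) \<subseteq>
      {h. set h \<subseteq> Pow {..<k} \<times> Pow {..<k} \<and> length h = t}"
  proof safe
    fix \<omega> S S' i
    assume "(S, S') \<in> set (execution k adv \<omega> t)"
    then obtain u where "S = newly_activated k adv (execution k adv \<omega> u)"
        "S' = transmitters k \<omega> (execution k adv \<omega> u)"
      by (auto simp: in_set_conv_nth nth_execution)
    then show "i \<in> S \<Longrightarrow> i < k" "i \<in> S' \<Longrightarrow> i < k"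
      by (auto simp: newly_activated_def transmitters_def)
  qed simp
  show "finite {h. set h \<subseteq> Pow {..<k} \<times> Pow {..<k} \<and> length h = t}"
    by (intro finite_lists_length_eq) auto
qed

section \<open>The distribution of the history\<close>

locale channel =
  fixes k :: nat and adv :: adversary and p :: "nat \<Rightarrow> real"
  assumes p_nonneg: "0 \<le> p r" and p_le_1: "p r \<le> 1"
begin

abbreviation run :: "(nat \<times> nat \<Rightarrow> bool) \<Rightarrow> nat \<Rightarrow> history" where
  "run \<equiv> execution k adv"

definition coin :: "nat \<times> nat \<Rightarrow> bool measure" where
  "coin c = measure_pmf (bernoulli_pmf (p (snd c)))"

lemma coin_space_eq: "coin_space k p = PiM ({..<k} \<times> {1..}) coin"
  by (simp add: coin_space_def coin_def[abs_def] case_prod_beta')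

sublocale coins: product_prob_space coin "{..<k} \<times> {1..}"
  by (simp add: product_prob_space_def product_sigma_finite_def coin_def
      measure_pmf.sigma_finite_measure_axioms product_prob_space_axioms_def
      measure_pmf.prob_space_axioms)

sublocale prob_space "coin_space k p"
  unfolding coin_space_eq by (rule coins.P.prob_space_axioms)

section \<open>Probabilities of finite histories\<close>

definition history_prob :: "history \<Rightarrow> real" where
  "history_prob h = prob {\<omega> \<in> space (coin_space k p). run \<omega> (length h) = h}"

lemma cylinder:
  assumes "J \<subseteq> {..<k} \<times> {1..}" "finite J"
  shows "{\<omega> \<in> space (coin_space k p). \<forall>c\<in>J. \<omega> c = v c} \<in> events"
    and "prob {\<omega> \<in> space (coin_space k p). \<forall>c\<in>J. \<omega> c = v c} =
      (\<Prod>c\<in>J. if v c then p (snd c) else 1 - p (snd c))"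
proof -
  have *: "{\<omega> \<in> space (coin_space k p). \<forall>c\<in>J. \<omega> c = v c} =
      prod_emb ({..<k} \<times> {1..}) coin J (\<Pi>\<^sub>E c\<in>J. {v c})"
    using assms by (auto simp: prod_emb_def coin_space_eq space_PiM Pi_iff)
  have sets: "{v c} \<in> sets (coin c)" for c
    by (simp add: coin_def)
  show "{\<omega> \<in> space (coin_space k p). \<forall>c\<in>J. \<omega> c = v c} \<in> events"
    unfolding * unfolding coin_space_eq using assms sets by (intro sets_PiM_I) auto
  show "prob {\<omega> \<in> space (coin_space k p). \<forall>c\<in>J. \<omega> c = v c} =
      (\<Prod>c\<in>J. if v c then p (snd c) else 1 - p (snd c))"
    unfolding * unfolding coin_space_eq using assms sets p_nonneg p_le_1
    by (subst coins.measure_PiM_emb) (auto simp: coin_def measure_pmf_single intro!: prod.cong)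
qed

lemma execution_eq_cylinder:
  "{\<omega> \<in> space (coin_space k p). run \<omega> t = run \<omega>0 t} =
    {\<omega> \<in> space (coin_space k p). \<forall>c\<in>revealed_coins k (run \<omega>0 t). \<omega> c = \<omega>0 c}"
  by (simp add: execution_eq_iff)

lemma execution_event: "{\<omega> \<in> space (coin_space k p). run \<omega> t = h} \<in> events"
proof (cases "\<exists>\<omega>0. h = run \<omega>0 t")
  case True
  then show ?thesis
    using cylinder(1)[OF revealed_coins_subset finite_revealed_coins]
    by (auto simp: execution_eq_cylinder)
next
  case False
  then have "{\<omega> \<in> space (coin_space k p). run \<omega> t = h} = {}"
    by auto
  then show ?thesis
    by (metis sets.empty_sets)
qed

lemma history_prob_nonneg: "0 \<le> history_prob h"
  by (simp add: history_prob_def)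

lemma history_prob_execution:
  "history_prob (run \<omega> t) =
    (\<Prod>c\<in>revealed_coins k (run \<omega> t). if \<omega> c then p (snd c) else 1 - p (snd c))"
  using cylinder(2)[OF revealed_coins_subset finite_revealed_coins]
  by (simp add: history_prob_def execution_eq_cylinder)

lemma
  shows execution_in_events: "{\<omega> \<in> space (coin_space k p). B (run \<omega> t)} \<in> events"
    and prob_execution: "prob {\<omega> \<in> space (coin_space k p). B (run \<omega> t)} =
      (\<Sum>h\<in>{h \<in> range (\<lambda>\<omega>. run \<omega> t). B h}. history_prob h)"
proof -
  let ?H = "{h \<in> range (\<lambda>\<omega>. run \<omega> t). B h}"
  let ?A = "\<lambda>h. {\<omega> \<in> space (coin_space k p). run \<omega> t = h}"
  have eq: "{\<omega> \<in> space (coin_space k p). B (run \<omega> t)} = (\<Union>h\<in>?H. ?A h)"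
    by auto
  have fin: "finite ?H"
    using finite_range_execution by (rule finite_subset[rotated]) auto
  show "{\<omega> \<in> space (coin_space k p). B (run \<omega> t)} \<in> events"
    unfolding eq using fin execution_event by (intro sets.finite_UN) auto
  have "prob (\<Union>h\<in>?H. ?A h) = (\<Sum>h\<in>?H. prob (?A h))"
    using fin execution_event by (intro finite_measure_finite_Union) (auto simp: disjoint_family_on_def)
  also have "\<dots> = (\<Sum>h\<in>?H. history_prob h)"
    by (intro sum.cong) (auto simp: history_prob_def)
  finally show "prob {\<omega> \<in> space (coin_space k p). B (run \<omega> t)} =
      (\<Sum>h\<in>?H. history_prob h)"
    unfolding eq .
qed

text \<open>For \<open>S \<subseteq> active k h\<close> this is the conditional probability, given
  the history \<open>h\<close>, that \<open>S\<close> is the set of transmitters of the next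
  round.\<close>

definition transmit_prob :: "history \<Rightarrow> nat set \<Rightarrow> real" where
  "transmit_prob h S = (\<Prod>i\<in>S. p (age h i)) * (\<Prod>i\<in>active k h - S. 1 - p (age h i))"

lemma transmit_prob_nonneg: "0 \<le> transmit_prob h S"
  using p_nonneg p_le_1 by (auto simp: transmit_prob_def intro!: mult_nonneg_nonneg prod_nonneg)

text \<open>Expand the product over the active stations of the factors
  \<open>p + (1 - p) = 1\<close>.\<close>

lemma sum_transmit_prob: "(\<Sum>S\<in>Pow (active k h). transmit_prob h S) = 1"
  using prod_add[OF finite_active, of "\<lambda>i. p (age h i)" "\<lambda>i. 1 - p (age h i)" k h]
  by (simp add: transmit_prob_def)

text \<open>The next round reads only fresh coins, so the probability factorises: the history is a
  Markov chain with transition probabilities \<open>transmit_prob h S\<close>.\<close>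

lemma history_prob_snoc:
  assumes h: "h = run \<omega>0 t" and S: "S \<subseteq> active k h"
  defines "h' \<equiv> h @ [(newly_activated k adv h, S)]"
  shows "h' \<in> range (\<lambda>\<omega>. run \<omega> (Suc t))"
    and "history_prob h' = history_prob h * transmit_prob h S"
proof -
  \<comment> \<open>A witness that \<open>S\<close> can follow \<open>h\<close>: the fresh coins are
    overwritten so that exactly \<open>S\<close> transmits, and the revealed coins keep their
    values.\<close>
  define \<omega>1 where "\<omega>1 c = (if c \<in> new_coins k h then fst c \<in> S else \<omega>0 c)" for c
  let ?q = "\<lambda>\<omega> c. if \<omega> c then p (snd c) else 1 - p (snd c)"
  have disj: "revealed_coins k h \<inter> new_coins k h = {}"
    unfolding h by (rule new_coins_disjoint)
  then have old: "\<forall>c\<in>revealed_coins k h. \<omega>1 c = \<omega>0 c"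
    by (auto simp: \<omega>1_def)
  then have run1: "run \<omega>1 t = h"
    unfolding h by (simp add: execution_eq_iff)
  have "transmitters k \<omega>1 h = {i \<in> active k h. \<omega>1 (i, age h i)}"
    unfolding h by (rule transmitters_execution)
  also have "\<dots> = S"
    using S by (auto simp: \<omega>1_def new_coins_def)
  finally have run1': "run \<omega>1 (Suc t) = h'"
    by (simp add: run1 Let_def h'_def)
  then show "h' \<in> range (\<lambda>\<omega>. run \<omega> (Suc t))"
    by (metis rangeI)
  have "history_prob h' = (\<Prod>c\<in>revealed_coins k h \<union> new_coins k h. ?q \<omega>1 c)"
    using history_prob_execution[of \<omega>1 "Suc t"] unfolding run1'
    by (simp add: h'_def revealed_coins_snoc)
  also have "\<dots> = (\<Prod>c\<in>revealed_coins k h. ?q \<omega>1 c) * (\<Prod>c\<in>new_coins k h. ?q \<omega>1 c)"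
    using disj by (intro prod.union_disjoint) auto
  also have "(\<Prod>c\<in>revealed_coins k h. ?q \<omega>1 c) = history_prob h"
    using old by (simp add: h history_prob_execution)
  also have "(\<Prod>c\<in>new_coins k h. ?q \<omega>1 c) =
      (\<Prod>i\<in>active k h. if i \<in> S then p (age h i) else 1 - p (age h i))"
    by (subst new_coins_def, subst prod.reindex)
      (auto simp: inj_on_def \<omega>1_def new_coins_def intro!: prod.cong)
  also have "\<dots> = transmit_prob h S"
    using S by (simp add: transmit_prob_def prod.If_cases Int_absorb1 Diff_eq)
  finally show "history_prob h' = history_prob h * transmit_prob h S" .
qed

text \<open>The tower property: the mean after one more round is the mean of the conditional mean
  given the present history.\<close>

lemma sum_history_Suc:
  "(\<Sum>h\<in>range (\<lambda>\<omega>. run \<omega> (Suc t)). history_prob h * F h) =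
    (\<Sum>h\<in>range (\<lambda>\<omega>. run \<omega> t). history_prob h *
      (\<Sum>S\<in>Pow (active k h). transmit_prob h S * F (h @ [(newly_activated k adv h, S)])))"
proof -
  let ?H = "\<lambda>t. range (\<lambda>\<omega>. run \<omega> t)"
  let ?snoc = "\<lambda>(h, S). h @ [(newly_activated k adv h, S)]"
  \<comment> \<open>The histories one round longer correspond one to one to pairs of a reachable
    history and a set of stations active in it.\<close>
  have img: "?H (Suc t) = ?snoc ` (SIGMA h : ?H t. Pow (active k h))"
  proof
    show "?H (Suc t) \<subseteq> ?snoc ` (SIGMA h : ?H t. Pow (active k h))"
    proof
      fix h' assume "h' \<in> ?H (Suc t)"
      then obtain \<omega> where "h' = run \<omega> (Suc t)"
        by auto
      then have "h' = ?snoc (run \<omega> t, transmitters k \<omega> (run \<omega> t))"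
        by (simp add: Let_def)
      moreover have "transmitters k \<omega> (run \<omega> t) \<subseteq> active k (run \<omega> t)"
        by (auto simp: transmitters_execution)
      ultimately show "h' \<in> ?snoc ` (SIGMA h : ?H t. Pow (active k h))"
        by blast
    qed
    show "?snoc ` (SIGMA h : ?H t. Pow (active k h)) \<subseteq> ?H (Suc t)"
      using history_prob_snoc(1)[OF refl] by (auto simp del: execution.simps)
  qed
  have "(\<Sum>h\<in>?H (Suc t). history_prob h * F h) =
      (\<Sum>x\<in>(SIGMA h : ?H t. Pow (active k h)). history_prob (?snoc x) * F (?snoc x))"
    unfolding img by (subst sum.reindex) (auto simp: inj_on_def)
  also have "\<dots> = (\<Sum>(h, S)\<in>(SIGMA h : ?H t. Pow (active k h)).
      history_prob h * (transmit_prob h S * F (?snoc (h, S))))"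
    using history_prob_snoc(2)[OF refl] by (intro sum.cong) (auto simp: mult.assoc)
  also have "\<dots> = (\<Sum>h\<in>?H t. \<Sum>S\<in>Pow (active k h).
      history_prob h * (transmit_prob h S * F (?snoc (h, S))))"
    by (subst sum.Sigma) (auto simp: finite_range_execution)
  finally show ?thesis
    by (simp add: sum_distrib_left)
qed

text \<open>Markov's inequality for a nonnegative supermartingale: its mean never exceeds its
  initial value, and on the event \<open>B\<close> it is at least \<open>exp a\<close>.\<close>

lemma prob_supermartingale_ge:
  assumes step: "\<And>\<omega> t. (\<Sum>S\<in>Pow (active k (run \<omega> t)). transmit_prob (run \<omega> t) S *
      F (run \<omega> t @ [(newly_activated k adv (run \<omega> t), S)])) \<le> F (run \<omega> t)"
    and nonneg: "\<And>h. 0 \<le> F h" and init: "F [] \<le> 1"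
    and bad: "\<And>\<omega>. B (run \<omega> t) \<Longrightarrow> exp a \<le> F (run \<omega> t)"
  shows "prob {\<omega> \<in> space (coin_space k p). B (run \<omega> t)} \<le> exp (- a)"
proof -
  let ?H = "\<lambda>t. range (\<lambda>\<omega>. run \<omega> t)"
  have mean: "(\<Sum>h\<in>?H t. history_prob h * F h) \<le> 1" for t
  proof (induction t)
    case 0
    have "history_prob [] = 1"
      using prob_space by (simp add: history_prob_def)
    then show ?case
      using init by simp
  next
    case (Suc t)
    have "(\<Sum>h\<in>?H (Suc t). history_prob h * F h) \<le> (\<Sum>h\<in>?H t. history_prob h * F h)"
      unfolding sum_history_Suc
      by (intro sum_mono mult_left_mono history_prob_nonneg) (auto intro: step)
    then show ?case
      using Suc by simp
  qed
  have "exp a * prob {\<omega> \<in> space (coin_space k p). B (run \<omega> t)} =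
      (\<Sum>h\<in>{h \<in> ?H t. B h}. history_prob h * exp a)"
    by (simp add: prob_execution sum_distrib_left mult.commute)
  also have "\<dots> \<le> (\<Sum>h\<in>{h \<in> ?H t. B h}. history_prob h * F h)"
    using bad by (intro sum_mono mult_left_mono history_prob_nonneg) auto
  also have "\<dots> \<le> (\<Sum>h\<in>?H t. history_prob h * F h)"
    using finite_range_execution history_prob_nonneg nonneg
    by (intro sum_mono2) auto
  also have "\<dots> \<le> 1"
    by (rule mean)
  finally show ?thesis
    by (simp add: exp_minus field_simps)
qed

end

section \<open>The probability that a station fails\<close>

text \<open>Since \<open>exp (2 * q) \<ge> 1 + 2 * q\<close>, it suffices that
  \<open>(1 + 2 * q) * (1 - q) = 1 + q * (1 - 2 * q)\<close> is at least 1.\<close>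

lemma one_minus_ge_exp:
  fixes q :: real
  assumes "0 \<le> q" "q \<le> 1 / 2"
  shows "exp (- 2 * q) \<le> 1 - q"
proof -
  have "exp (- 2 * q) \<le> inverse (1 + 2 * q)"
    using exp_ge_add_one_self[of "2 * q"] assms
    by (simp add: exp_minus le_imp_inverse_le)
  also have "\<dots> \<le> 1 - q"
  proof -
    have "0 \<le> q * (1 - 2 * q)"
      using assms by simp
    then show ?thesis
      using assms by (simp add: field_simps)
  qed
  finally show ?thesis .
qed

text \<open>Since \<open>exp z \<ge> 1 + z\<close>, it suffices that
  \<open>(1 + z) * (1 - z / 2) = 1 + z * (1 - z) / 2\<close> is at least 1.\<close>

lemma one_minus_exp_ge:
  fixes z :: real
  assumes "0 \<le> z" "z \<le> 1"
  shows "z / 2 \<le> 1 - exp (- z)"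
proof -
  have "exp (- z) \<le> inverse (1 + z)"
    using exp_ge_add_one_self[of z] assms by (simp add: exp_minus le_imp_inverse_le)
  also have "\<dots> \<le> 1 - z / 2"
  proof -
    have "0 \<le> z * (1 - z)"
      using assms by simp
    then show ?thesis
      using assms by (simp add: field_simps)
  qed
  finally show ?thesis
    by simp
qed

lemma sum_Pow_singletons:
  assumes "finite A"
  shows "(\<Sum>S\<in>Pow A. f S * of_bool (is_singleton S)) = (\<Sum>j\<in>A. f {j} :: real)"
proof -
  have "(\<Sum>j\<in>A. f {j}) = (\<Sum>S\<in>(\<lambda>j. {j}) ` A. f S)"
    by (subst sum.reindex) auto
  also have "\<dots> = (\<Sum>S\<in>Pow A. f S * of_bool (is_singleton S))"
    using assms by (intro sum.mono_neutral_cong_left) (auto simp: is_singleton_def)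
  finally show ?thesis ..
qed

section \<open>The exponential supermartingale\<close>

context channel
begin

definition load :: "history \<Rightarrow> real" where
  "load h = (\<Sum>j\<in>active k h. p (age h j))"

text \<open>The conditional probability that \<open>i\<close> succeeds in the next round. For an
  inactive station \<open>transmit_prob h {i}\<close> has no such meaning, hence the default
  0.\<close>

definition solo_prob :: "history \<Rightarrow> nat \<Rightarrow> real" where
  "solo_prob h i = (if i \<in> active k h then transmit_prob h {i} else 0)"

definition success_prob :: "history \<Rightarrow> real" where
  "success_prob h = (\<Sum>j\<in>active k h. transmit_prob h {j})"

text \<open>The two inequalities say that the next round is one of the local rounds 1 to
  \<open>T\<close> of station \<open>i\<close>.\<close>

definition in_window :: "nat \<Rightarrow> history \<Rightarrow> nat \<Rightarrow> bool" where
  "in_window T h i \<longleftrightarrow> (\<exists>s<length h. i \<in> fst (h ! s) \<and> length h \<le> s + T)"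

text \<open>A success of \<open>i\<close> annihilates the product, and a success of another station
  costs \<open>1 / k\<close> in the exponent. The two positive terms compensate half of these
  effects in the mean. Outside the window the product is frozen.\<close>

definition factor :: "nat \<Rightarrow> nat \<Rightarrow> history \<Rightarrow> nat set \<Rightarrow> real" where
  "factor T i h S =
    (if in_window T h i then
       (if S = {i} then 0
        else exp (solo_prob h i / 2 + success_prob h / (2 * k) - of_bool (is_singleton S) / k))
     else 1)"

definition potential :: "nat \<Rightarrow> nat \<Rightarrow> history \<Rightarrow> real" where
  "potential T i h = (\<Prod>u<length h. factor T i (take u h) (snd (h ! u)))"

lemma potential_snoc: "potential T i (h @ [z]) = potential T i h * factor T i h (snd z)"
  by (simp add: potential_def nth_append)

lemma factor_nonneg: "0 \<le> factor T i h S"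
  by (simp add: factor_def)

lemma potential_nonneg: "0 \<le> potential T i h"
  by (simp add: potential_def prod_nonneg factor_nonneg)

lemma solo_prob_nonneg: "0 \<le> solo_prob h i"
  by (simp add: solo_prob_def transmit_prob_nonneg)

lemma success_prob_nonneg: "0 \<le> success_prob h"
  by (simp add: success_prob_def sum_nonneg transmit_prob_nonneg)

lemma solo_prob_le: "solo_prob h i \<le> success_prob h"
  unfolding solo_prob_def success_prob_def
  by (auto intro!: member_le_sum sum_nonneg simp: transmit_prob_nonneg)

text \<open>With \<open>x\<close> and \<open>y\<close> the conditional probabilities of a success of
  \<open>i\<close> and of any success, the mean is \<open>exp (x / 2 + y / (2 * k))\<close> times an
  expression of the form \<open>1 - z\<close> with \<open>z \<ge> x / 2 + y / (2 * k)\<close>. The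
  claim follows from \<open>1 - z \<le> exp (- z)\<close>.\<close>

lemma sum_transmit_prob_factor:
  assumes "0 < k"
  shows "(\<Sum>S\<in>Pow (active k h). transmit_prob h S * factor T i h S) \<le> 1"
proof (cases "in_window T h i")
  case False
  then show ?thesis
    by (simp add: factor_def sum_transmit_prob)
next
  case True
  define x where "x = solo_prob h i"
  define y where "y = success_prob h"
  define \<delta> where "\<delta> = exp (- (1 / real k))"
  have x: "0 \<le> x" "x \<le> y"
    by (simp_all add: x_def y_def solo_prob_nonneg solo_prob_le)
  have \<delta>: "1 / real k / 2 \<le> 1 - \<delta>"
    unfolding \<delta>_def using assms by (intro one_minus_exp_ge) auto
  \<comment> \<open>Inside the window the factor is affine in two indicators. A success of another
    station contributes the weight \<open>\<delta>\<close>, and for \<open>S = {i}\<close> the terms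
    cancel as \<open>1 - (1 - \<delta>) - \<delta> = 0\<close>.\<close>
  have factor_eq: "factor T i h S = exp (x / 2 + y / (2 * k)) *
      (1 - of_bool (is_singleton S) * (1 - \<delta>) - of_bool (S = {i}) * \<delta>)" for S
  proof (cases "S = {i}")
    case True
    then show ?thesis
      using \<open>in_window T h i\<close> by (simp add: factor_def is_singletonI)
  next
    case False
    have "exp (x / 2 + y / (2 * k) - 1 / k) = exp (x / 2 + y / (2 * k)) * \<delta>"
      unfolding \<delta>_def by (simp flip: exp_add)
    then show ?thesis
      using False \<open>in_window T h i\<close>
      by (cases "is_singleton S") (simp_all add: factor_def x_def y_def)
  qed
  have singles: "(\<Sum>S\<in>Pow (active k h). transmit_prob h S * of_bool (is_singleton S)) = y"
    unfolding y_def success_prob_def by (rule sum_Pow_singletons) simp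
  have "(\<Sum>S\<in>Pow (active k h). transmit_prob h S * of_bool (S = {i})) =
      (\<Sum>S\<in>Pow (active k h). if S = {i} then transmit_prob h S else 0)"
    by (intro sum.cong) auto
  then have self: "(\<Sum>S\<in>Pow (active k h). transmit_prob h S * of_bool (S = {i})) = x"
    by (simp add: x_def solo_prob_def)
  have "(\<Sum>S\<in>Pow (active k h). transmit_prob h S * factor T i h S) =
      (\<Sum>S\<in>Pow (active k h). exp (x / 2 + y / (2 * k)) * (transmit_prob h S
        - transmit_prob h S * of_bool (is_singleton S) * (1 - \<delta>)
        - transmit_prob h S * of_bool (S = {i}) * \<delta>))"
    by (intro sum.cong) (auto simp: factor_eq algebra_simps)
  also have "\<dots> = exp (x / 2 + y / (2 * k)) * (1 - y * (1 - \<delta>) - x * \<delta>)"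
    unfolding sum_distrib_left[symmetric] sum_subtractf sum_distrib_right[symmetric]
      singles self sum_transmit_prob ..
  also have "\<dots> \<le> exp (x / 2 + y / (2 * k)) * exp (- (x / 2 + y / (2 * k)))"
  proof (rule mult_left_mono)
    \<comment> \<open>Regroup \<open>y * (1 - \<delta>) + x * \<delta>\<close> as
      \<open>x + (y - x) * (1 - \<delta>)\<close>. Half of the summand \<open>x\<close> is kept, and
      the other half pays for the share \<open>x / (2 * k)\<close> of
      \<open>y / (2 * k)\<close>.\<close>
    have "(y - x) * (1 / real k / 2) \<le> (y - x) * (1 - \<delta>)"
      using \<delta> x by (intro mult_left_mono) auto
    moreover have "x * (1 / real k / 2) \<le> x / 2"
      using mult_left_mono[of "1 / real k" 1 "x / 2"] x assms by simp
    ultimately have "1 - y * (1 - \<delta>) - x * \<delta> \<le> 1 - (x / 2 + y / (2 * k))"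
      by (simp add: algebra_simps diff_divide_distrib)
    also have "\<dots> \<le> exp (- (x / 2 + y / (2 * k)))"
      using exp_ge_add_one_self[of "- (x / 2 + y / (2 * k))"] by (simp only: diff_conv_add_uminus)
    finally show "1 - y * (1 - \<delta>) - x * \<delta> \<le> exp (- (x / 2 + y / (2 * k)))" .
  qed simp
  also have "\<dots> = 1"
    by (simp flip: exp_add)
  finally show ?thesis .
qed

lemma potential_step:
  assumes "0 < k"
  shows "(\<Sum>S\<in>Pow (active k h). transmit_prob h S *
    potential T i (h @ [(newly_activated k adv h, S)])) \<le> potential T i h"
proof -
  have "(\<Sum>S\<in>Pow (active k h). transmit_prob h S *
      potential T i (h @ [(newly_activated k adv h, S)])) =
    potential T i h * (\<Sum>S\<in>Pow (active k h). transmit_prob h S * factor T i h S)"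
    by (simp add: potential_snoc sum_distrib_left mult_ac)
  also have "\<dots> \<le> potential T i h * 1"
    using assms by (intro mult_left_mono sum_transmit_prob_factor potential_nonneg)
  finally show ?thesis
    by simp
qed

section \<open>Potential, successes and load along an execution\<close>

lemma potential_run:
  "potential T i (run \<omega> t) = (\<Prod>u<t. factor T i (run \<omega> u) (transmitters k \<omega> (run \<omega> u)))"
  by (simp add: potential_def take_execution nth_execution)

lemma in_window_run:
  assumes "activated_at k adv \<omega> s i"
  shows "in_window T (run \<omega> u) i \<longleftrightarrow> s < u \<and> u \<le> s + T"
proof -
  have "i \<in> fst (run \<omega> u ! s') \<longleftrightarrow> s' = s" if "s' < u" for s'
    using that assms activated_at_unique[of k adv \<omega> s' i s] by (auto simp: mem_fst_execution_iff)
  then show ?thesis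
    by (auto simp: in_window_def)
qed

lemma activated_before_success:
  assumes "succeeds_at k adv \<omega> u i"
  shows "\<exists>s<u. activated_at k adv \<omega> s i"
proof -
  have "i \<in> active k (run \<omega> u)"
    using assms unfolding succeeds_at_def transmitters_execution by blast
  then show ?thesis
    by (simp add: active_execution)
qed

text \<open>A success switches its station off, so mapping each successful round to its transmitter
  is injective into the \<open>k\<close> stations.\<close>

lemma sum_singleton_rounds_le:
  assumes fin: "finite U"
  shows "(\<Sum>u\<in>U. of_bool (is_singleton (transmitters k \<omega> (run \<omega> u)))) \<le> real k"
proof -
  let ?U = "{u \<in> U. is_singleton (transmitters k \<omega> (run \<omega> u))}"
  let ?f = "\<lambda>u. the_elem (transmitters k \<omega> (run \<omega> u))"
  have f: "succeeds_at k adv \<omega> u (?f u)" if "u \<in> ?U" for u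
    using that by (auto simp: succeeds_at_def is_singleton_the_elem)
  have "inj_on ?f ?U"
    using f by (intro inj_onI) (metis succeeds_at_unique)
  moreover have "?f u < k" if "u \<in> ?U" for u
    using f[OF that] transmitters_subset[of k \<omega> "run \<omega> u"] by (auto simp: succeeds_at_def)
  then have "?f ` ?U \<subseteq> {..<k}"
    by blast
  ultimately have "card ?U \<le> card {..<k}"
    by (intro card_inj_on_le) auto
  moreover have "(\<Sum>u\<in>U. of_bool (is_singleton (transmitters k \<omega> (run \<omega> u)))) = real (card ?U)"
    using fin by (simp add: of_bool_def sum.If_cases Int_def)
  ultimately show ?thesis
    by simp
qed

lemma sum_load_le:
  assumes anti: "antimono_on {1..} p"
  shows "(\<Sum>u\<in>{s<..s + T}. load (run \<omega> u)) \<le> k * (\<Sum>r\<in>{1..T}. p r)"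
proof -
  let ?g = "\<lambda>j u. of_bool (j \<in> active k (run \<omega> u)) * p (age (run \<omega> u) j)"
  have "load (run \<omega> u) = (\<Sum>j<k. ?g j u)" for u
    unfolding load_def by (intro sum.mono_neutral_cong_left) (auto simp: active_def)
  then have "(\<Sum>u\<in>{s<..s + T}. load (run \<omega> u)) = (\<Sum>u\<in>{s<..s + T}. \<Sum>j<k. ?g j u)"
    by simp
  also have "\<dots> = (\<Sum>j<k. \<Sum>u\<in>{s<..s + T}. ?g j u)"
    by (rule sum.swap)
  also have "\<dots> \<le> (\<Sum>j<k. \<Sum>r\<in>{1..T}. p r)"
  proof (rule sum_mono)
    fix j
    show "(\<Sum>u\<in>{s<..s + T}. ?g j u) \<le> (\<Sum>r\<in>{1..T}. p r)"
    proof (cases "\<exists>a. activated_at k adv \<omega> a j")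
      case False
      then have "(\<Sum>u\<in>{s<..s + T}. ?g j u) = 0"
        by (simp add: active_execution)
      then show ?thesis
        by (simp add: sum_nonneg p_nonneg)
    next
      case True
      then obtain a where a: "activated_at k adv \<omega> a j"
        by blast
      \<comment> \<open>Station \<open>j\<close> counts only after both the start of the window and
        its own activation. Its age is then at least \<open>u - m\<close>, which runs through
        distinct values in \<open>{1..T}\<close>, so monotonicity of \<open>p\<close> treats early
        and late activation alike.\<close>
      define m where "m = max s a"
      have age: "?g j u \<le> p (u - m)" if "m < u" for u
      proof -
        have "?g j u \<le> p (age (run \<omega> u) j)"
          using p_nonneg by simp
        also have "\<dots> \<le> p (u - m)"
          using that a monotone_onD[OF anti, of "u - m" "u - a"]
          by (auto simp: age_execution m_def)
        finally show ?thesis .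
      qed
      have "(\<Sum>u\<in>{s<..s + T}. ?g j u) = (\<Sum>u\<in>{m<..s + T}. ?g j u)"
        using a by (intro sum.mono_neutral_right)
          (auto simp: m_def active_execution dest: activated_at_unique)
      also have "\<dots> \<le> (\<Sum>u\<in>{m<..s + T}. p (u - m))"
        using age by (intro sum_mono) auto
      also have "\<dots> = (\<Sum>r\<in>(\<lambda>u. u - m) ` {m<..s + T}. p r)"
        by (subst sum.reindex) (auto simp: inj_on_def)
      also have "\<dots> \<le> (\<Sum>r\<in>{1..T}. p r)"
        by (intro sum_mono2) (auto simp: p_nonneg m_def)
      finally show ?thesis .
    qed
  qed
  finally show ?thesis
    by simp
qed

text \<open>Each other active station is silent with probability
  \<open>1 - q \<ge> exp (- 2 * q)\<close>, where \<open>q \<le> 1 / 2\<close>. The product of these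
  bounds is an exponential in the load.\<close>

lemma transmit_prob_singleton_ge:
  assumes half: "\<And>r. p r \<le> 1 / 2" and i: "i \<in> active k h"
  shows "p (age h i) * exp (- 2 * load h) \<le> transmit_prob h {i}"
proof -
  have "exp (- 2 * load h) = (\<Prod>j\<in>active k h. exp (- 2 * p (age h j)))"
    by (simp add: load_def exp_sum sum_distrib_left)
  also have "\<dots> \<le> (\<Prod>j\<in>active k h. 1 - p (age h j))"
    using half p_nonneg by (intro prod_mono conjI one_minus_ge_exp) auto
  \<comment> \<open>Removing the factor of \<open>i\<close> itself, which is at most 1, can only
    enlarge the product.\<close>
  also have "\<dots> \<le> (\<Prod>j\<in>active k h - {i}. 1 - p (age h j))"
    using i p_nonneg p_le_1
    by (subst prod.remove[OF _ i]) (auto intro!: mult_left_le_one_le prod_nonneg)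
  finally show ?thesis
    using p_nonneg by (simp add: transmit_prob_def mult_left_mono)
qed

lemma success_prob_ge:
  assumes half: "\<And>r. p r \<le> 1 / 2"
  shows "load h * exp (- 2 * load h) \<le> success_prob h"
proof -
  have "load h * exp (- 2 * load h) = (\<Sum>j\<in>active k h. p (age h j) * exp (- 2 * load h))"
    by (simp add: load_def sum_distrib_right)
  also have "\<dots> \<le> success_prob h"
    unfolding success_prob_def using half by (intro sum_mono transmit_prob_singleton_ge)
  finally show ?thesis .
qed

section \<open>The failure of a single station\<close>

definition fails :: "(nat \<times> nat \<Rightarrow> bool) \<Rightarrow> nat \<Rightarrow> nat \<Rightarrow> nat \<Rightarrow> bool" where
  "fails \<omega> T s i \<longleftrightarrow> activated_at k adv \<omega> s i \<and> (\<forall>r\<le>T. \<not> succeeds_at k adv \<omega> (s + r) i)"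

text \<open>The total load of the window is at most \<open>\<theta> * T / 2\<close>, so at least
  half of its rounds have load at most \<open>\<theta>\<close>. Each of these adds at least
  \<open>m / 2\<close> to the exponent, together \<open>m * T / 4\<close>. The charges for successes
  of other stations sum to at most 1, which explains \<open>a + 1\<close>.\<close>

lemma potential_ge_if_fails:
  assumes k: "0 < k" and anti: "antimono_on {1..} p" and half: "\<And>r. p r \<le> 1 / 2"
    and \<theta>: "0 < \<theta>" "2 * k * (\<Sum>r\<in>{1..T}. p r) \<le> \<theta> * T"
    and m: "0 \<le> m" "m \<le> p T * exp (- 2)" "m \<le> exp (- 2 * \<theta>) / k"
    and a: "a + 1 \<le> m * T / 4"
    and fails: "fails \<omega> T s i" and t: "s + T < t"
  shows "exp a \<le> potential T i (run \<omega> t)"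
proof -
  have act: "activated_at k adv \<omega> s i" and nosucc: "\<And>r. r \<le> T \<Longrightarrow> \<not> succeeds_at k adv \<omega> (s + r) i"
    using fails by (auto simp: fails_def)
  let ?W = "{s<..s + T}"
  let ?x = "\<lambda>u. solo_prob (run \<omega> u) i" and ?y = "\<lambda>u. success_prob (run \<omega> u)"
  let ?z = "\<lambda>u. of_bool (is_singleton (transmitters k \<omega> (run \<omega> u))) :: real"
  have fac: "factor T i (run \<omega> u) (transmitters k \<omega> (run \<omega> u)) =
      exp (?x u / 2 + ?y u / (2 * k) - ?z u / k)" if "u \<in> ?W" for u
  proof -
    have "\<not> succeeds_at k adv \<omega> u i"
      using nosucc[of "u - s"] that by (auto simp: le_diff_conv add.commute)
    then show ?thesis
      using that by (simp add: factor_def in_window_run[OF act] succeeds_at_def)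
  qed
  have "potential T i (run \<omega> t) =
      (\<Prod>u\<in>?W. factor T i (run \<omega> u) (transmitters k \<omega> (run \<omega> u)))"
    unfolding potential_run using t
    by (intro prod.mono_neutral_right) (auto simp: factor_def in_window_run[OF act])
  also have "\<dots> = (\<Prod>u\<in>?W. exp (?x u / 2 + ?y u / (2 * k) - ?z u / k))"
    using fac by (intro prod.cong) auto
  also have "\<dots> = exp (\<Sum>u\<in>?W. (?x u / 2 + ?y u / (2 * k) - ?z u / k))"
    by (simp add: exp_sum)
  also have "(\<Sum>u\<in>?W. (?x u / 2 + ?y u / (2 * k) - ?z u / k)) =
      (\<Sum>u\<in>?W. (?x u + ?y u / k) / 2) - (\<Sum>u\<in>?W. ?z u) / k"
    by (simp only: sum_subtractf sum_divide_distrib add_divide_distrib divide_divide_eq_left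
        of_nat_mult of_nat_numeral mult.commute)
  finally have pot: "potential T i (run \<omega> t) =
      exp ((\<Sum>u\<in>?W. (?x u + ?y u / k) / 2) - (\<Sum>u\<in>?W. ?z u) / k)" .
  have z: "(\<Sum>u\<in>?W. ?z u) / k \<le> 1"
    using sum_singleton_rounds_le[of ?W \<omega>] k by simp

  let ?G = "{u \<in> ?W. load (run \<omega> u) \<le> \<theta>}"
  have good: "m \<le> ?x u + ?y u / k" if "u \<in> ?G" for u
  \<comment> \<open>At load at most 1 the fixed station, which has not yet succeeded and so is
    active, makes \<open>?x u\<close> large. In the other case the load lies between 1 and
    \<open>\<theta>\<close>, and \<open>?y u\<close> is large.\<close>
  proof (cases "load (run \<omega> u) \<le> 1")
    case True
    have u: "s < u" "u \<le> s + T"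
      using that by auto
    have "\<not> succeeds_at k adv \<omega> u' i" if "u' < u" for u'
    proof
      assume succ: "succeeds_at k adv \<omega> u' i"
      then have "s < u'"
        using activated_before_success activated_at_unique act by blast
      then show False
        using nosucc[of "u' - s"] succ that u by (simp add: le_diff_conv)
    qed
    then have active: "i \<in> active k (run \<omega> u)"
      using act u by (auto simp: active_execution)
    have "p T \<le> p (age (run \<omega> u) i)"
      using u monotone_onD[OF anti, of "u - s" T] by (simp add: age_execution[OF act])
    then have "p T * exp (- 2) \<le> p (age (run \<omega> u) i) * exp (- 2 * load (run \<omega> u))"
      using True p_nonneg by (intro mult_mono) auto
    also have "\<dots> \<le> ?x u"
      using transmit_prob_singleton_ge[OF half active] active by (simp add: solo_prob_def)
    finally show ?thesis
      using m success_prob_nonneg[of "run \<omega> u"] by (smt (verit) divide_nonneg_nonneg of_nat_0_le_iff)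
  next
    case False
    then have "exp (- 2 * \<theta>) \<le> load (run \<omega> u) * exp (- 2 * load (run \<omega> u))"
      using that mult_mono[of 1 "load (run \<omega> u)" "exp (- 2 * \<theta>)" "exp (- 2 * load (run \<omega> u))"]
      by simp
    also have "\<dots> \<le> ?y u"
      using half by (rule success_prob_ge)
    finally have "exp (- 2 * \<theta>) / k \<le> ?y u / k"
      by (simp add: divide_right_mono)
    then show ?thesis
      using m solo_prob_nonneg[of "run \<omega> u" i] by simp
  qed
  \<comment> \<open>Markov's inequality over the rounds of the window: the rounds of load above
    \<open>\<theta>\<close> make up at most half of it.\<close>
  have "\<theta> * card (?W - ?G) = (\<Sum>u\<in>?W - ?G. \<theta>)"
    by simp
  also have "\<dots> \<le> (\<Sum>u\<in>?W - ?G. load (run \<omega> u))"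
    by (intro sum_mono) auto
  also have "\<dots> \<le> (\<Sum>u\<in>?W. load (run \<omega> u))"
    by (intro sum_mono2) (auto simp: load_def sum_nonneg p_nonneg)
  also have "\<dots> \<le> k * (\<Sum>r\<in>{1..T}. p r)"
    using anti by (rule sum_load_le)
  also have "\<dots> \<le> \<theta> * (T / 2)"
    using \<theta> by simp
  finally have "real (card (?W - ?G)) \<le> T / 2"
    using \<theta> by simp
  moreover have "card ((?W - ?G) \<union> ?G) = card (?W - ?G) + card ?G"
    by (intro card_Un_disjoint) auto
  moreover have "(?W - ?G) \<union> ?G = ?W"
    by auto
  ultimately have "card (?W - ?G) + card ?G = T" "real (card (?W - ?G)) \<le> T / 2"
    by simp_all
  then have card_G: "T / 2 \<le> card ?G"
    by linarith
  have "a + 1 \<le> (T / 2) * (m / 2)"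
    using a by (simp add: mult.commute)
  also have "\<dots> \<le> card ?G * (m / 2)"
    using card_G m by (intro mult_right_mono) auto
  also have "\<dots> = (\<Sum>u\<in>?G. m / 2)"
    by simp
  also have "\<dots> \<le> (\<Sum>u\<in>?G. (?x u + ?y u / k) / 2)"
    using good by (intro sum_mono) auto
  also have "\<dots> \<le> (\<Sum>u\<in>?W. (?x u + ?y u / k) / 2)"
    by (intro sum_mono2) (auto simp: solo_prob_nonneg success_prob_nonneg)
  finally show ?thesis
    using z by (simp add: pot)
qed

text \<open>Once the window has passed, failure can be read off the history. This gives
  measurability and fits the form of the supermartingale bound.\<close>

lemma fails_iff:
  assumes "s + T < t"
  shows "fails \<omega> T s i \<longleftrightarrow>
    i \<in> fst (run \<omega> t ! s) \<and> (\<forall>r\<le>T. snd (run \<omega> t ! (s + r)) \<noteq> {i})"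
  using assms by (auto simp: fails_def nth_execution activated_at_def succeeds_at_def)

text \<open>The activation round is random and unbounded, but one potential serves all its values
  because its window opens when the station is activated. The bound at time \<open>t\<close> is
  uniform in \<open>t\<close>, and continuity from below carries it to the whole event.\<close>

lemma
  assumes k: "0 < k" and anti: "antimono_on {1..} p" and half: "\<And>r. p r \<le> 1 / 2"
    and \<theta>: "0 < \<theta>" "2 * k * (\<Sum>r\<in>{1..T}. p r) \<le> \<theta> * T"
    and m: "0 \<le> m" "m \<le> p T * exp (- 2)" "m \<le> exp (- 2 * \<theta>) / k"
    and a: "a + 1 \<le> m * T / 4"
  shows fails_event: "{\<omega> \<in> space (coin_space k p). \<exists>s. fails \<omega> T s i} \<in> events"
    and prob_fails_le: "prob {\<omega> \<in> space (coin_space k p). \<exists>s. fails \<omega> T s i} \<le> exp (- a)"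
proof -
  define B where "B t h \<longleftrightarrow> (\<exists>s. s + T < t \<and> i \<in> fst (h ! s) \<and>
    (\<forall>r\<le>T. snd (h ! (s + r)) \<noteq> {i}))" for t and h :: history
  let ?A = "\<lambda>t. {\<omega> \<in> space (coin_space k p). B t (run \<omega> t)}"
  have B: "B t (run \<omega> t) \<longleftrightarrow> (\<exists>s. s + T < t \<and> fails \<omega> T s i)" for t \<omega>
    by (auto simp: B_def fails_iff)
  have eq: "{\<omega> \<in> space (coin_space k p). \<exists>s. fails \<omega> T s i} = (\<Union>t. ?A t)"
    unfolding B by (auto intro!: lessI)
  have A: "?A t \<in> events" for t
    by (rule execution_in_events)
  then show "{\<omega> \<in> space (coin_space k p). \<exists>s. fails \<omega> T s i} \<in> events"
    unfolding eq by blast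
  have "prob (?A t) \<le> exp (- a)" for t
  proof (rule prob_supermartingale_ge)
    show "exp a \<le> potential T i (run \<omega> t)" if "B t (run \<omega> t)" for \<omega>
      using that potential_ge_if_fails[OF assms] by (auto simp: B)
  qed (simp_all add: potential_step[OF k] potential_nonneg potential_def[of _ _ "[]"])
  moreover have "incseq ?A"
    unfolding B by (force simp: incseq_def)
  then have "(\<lambda>t. prob (?A t)) \<longlonglongrightarrow> prob (\<Union>t. ?A t)"
    using A by (intro finite_Lim_measure_incseq) auto
  ultimately show "prob {\<omega> \<in> space (coin_space k p). \<exists>s. fails \<omega> T s i} \<le> exp (- a)"
    unfolding eq by (intro LIMSEQ_le_const2) auto
qed

lemma succeeds_event:
  "{\<omega> \<in> space (coin_space k p). \<exists>s r. activated_at k adv \<omega> s i \<and>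
     succeeds_at k adv \<omega> (s + r) i \<and> R r} \<in> events"
proof -
  have "{\<omega> \<in> space (coin_space k p). \<exists>s r. activated_at k adv \<omega> s i \<and>
      succeeds_at k adv \<omega> (s + r) i \<and> R r} =
    (\<Union>s. \<Union>r\<in>Collect R. {\<omega> \<in> space (coin_space k p).
      (\<lambda>h. i \<in> fst (h ! s) \<and> snd (h ! (s + r)) = {i}) (run \<omega> (Suc (s + r)))})"
    by (auto simp: nth_execution activated_at_def succeeds_at_def simp del: execution.simps)
  also have "\<dots> \<in> events"
    by (intro sets.countable_UN'' execution_in_events) auto
  finally show ?thesis .
qed

text \<open>A union bound over the \<open>k\<close> stations, outside the null set on which some
  station is never activated. The predicate \<open>R\<close> stands for a real time bound that every
  \<open>r \<le> T\<close> satisfies.\<close>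

lemma prob_all_succeed_ge:
  assumes k: "0 < k" and anti: "antimono_on {1..} p" and half: "\<And>r. p r \<le> 1 / 2"
    and \<theta>: "0 < \<theta>" "2 * k * (\<Sum>r\<in>{1..T}. p r) \<le> \<theta> * T"
    and m: "0 \<le> m" "m \<le> p T * exp (- 2)" "m \<le> exp (- 2 * \<theta>) / k"
    and a: "a + 1 \<le> m * T / 4"
    and act: "AE \<omega> in coin_space k p. \<forall>i<k. \<exists>s. activated_at k adv \<omega> s i"
    and R: "\<And>r. r \<le> T \<Longrightarrow> R r"
  shows "1 - k * exp (- a) \<le> prob {\<omega> \<in> space (coin_space k p).
    \<forall>i<k. \<exists>s r. activated_at k adv \<omega> s i \<and> succeeds_at k adv \<omega> (s + r) i \<and> R r}"
    (is "_ \<le> prob ?G")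
proof -
  let ?F = "\<lambda>i. {\<omega> \<in> space (coin_space k p). \<exists>s. fails \<omega> T s i}"
  note F = fails_event[OF assms(1-9)] prob_fails_le[OF assms(1-9)]
  have "?G = space (coin_space k p) \<inter> (\<Inter>i<k. {\<omega> \<in> space (coin_space k p).
      \<exists>s r. activated_at k adv \<omega> s i \<and> succeeds_at k adv \<omega> (s + r) i \<and> R r})"
    by auto
  also have "\<dots> \<in> events"
    using k by (intro sets.Int sets.top sets.finite_INT succeeds_event) auto
  finally have G: "?G \<in> events" .
  have "1 - prob ?G = prob (space (coin_space k p) - ?G)"
    by (rule prob_compl[OF G, symmetric])
  also have "\<dots> \<le> prob (\<Union>i<k. ?F i)"
  proof (rule finite_measure_mono_AE)
    show "AE \<omega> in coin_space k p. \<omega> \<in> space (coin_space k p) - ?G \<longrightarrow> \<omega> \<in> (\<Union>i<k. ?F i)"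
      using act
    proof eventually_elim
      case (elim \<omega>)
      show ?case
      proof
        assume \<omega>: "\<omega> \<in> space (coin_space k p) - ?G"
        then obtain i where i: "i < k" "\<And>s r. activated_at k adv \<omega> s i \<Longrightarrow>
            succeeds_at k adv \<omega> (s + r) i \<Longrightarrow> \<not> R r"
          by auto
        obtain s where "activated_at k adv \<omega> s i"
          using elim i by blast
        then have "fails \<omega> T s i"
          using i R by (auto simp: fails_def)
        then show "\<omega> \<in> (\<Union>i<k. ?F i)"
          using i \<omega> by auto
      qed
    qed
    show "(\<Union>i<k. ?F i) \<in> events"
      using F(1) by (intro sets.finite_UN) auto
  qed
  also have "\<dots> \<le> (\<Sum>i<k. prob (?F i))"
    using F(1) by (intro finite_measure_subadditive_finite) auto
  also have "\<dots> \<le> (\<Sum>i<k. exp (- a))"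
    using F(2) by (intro sum_mono)
  finally show ?thesis
    by simp
qed

end

section \<open>The protocol SublinearDecrease\<close>

text \<open>The tangent bound gives \<open>ln y \<le> ln x + (y / x - 1)\<close>. Multiply by
  \<open>x\<close> and use \<open>ln x \<ge> 1\<close>, which is where \<open>exp 1 \<le> x\<close>
  enters.\<close>

lemma ln_div_antimono:
  fixes x y :: real
  assumes "exp 1 \<le> x" "x \<le> y"
  shows "ln y / y \<le> ln x / x"
proof -
  have x: "0 < x" "0 < y"
    using assms exp_gt_zero[of 1] by linarith+
  have "1 \<le> ln x"
    using assms x by (simp add: ln_ge_iff)
  have "ln y = ln x + ln (y / x)"
    using x by (simp add: ln_div)
  also have "\<dots> \<le> ln x + (y / x - 1)"
    using x ln_le_minus_one[of "y / x"] by simp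
  finally have "x * ln y \<le> x * (ln x + (y / x - 1))"
    using x by (intro mult_left_mono) auto
  also have "\<dots> = x * ln x + (y - x)"
    using x by (simp add: algebra_simps)
  also have "\<dots> \<le> x * ln x + (y - x) * ln x"
    using \<open>1 \<le> ln x\<close> assms mult_left_mono[of 1 "ln x" "y - x"] by simp
  also have "\<dots> = y * ln x"
    by (simp add: algebra_simps)
  finally show ?thesis
    using x by (simp add: field_simps)
qed

lemma ln_le_half:
  fixes x :: real
  assumes "0 < x"
  shows "ln x \<le> x / 2"
proof -
  have "ln x = ln (x / 2) + ln 2"
    using assms by (simp add: ln_div)
  also have "\<dots> \<le> (x / 2 - 1) + 1"
    using assms ln_le_minus_one[of "x / 2"] ln_le_minus_one[of "2 :: real"] by simp
  finally show ?thesis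
    by simp
qed

text \<open>From \<open>1 - 1 / 8 \<le> exp (- 1 / 8)\<close> one gets
  \<open>(7 / 8) ^ 8 \<le> exp (- 1)\<close>, and the left side exceeds \<open>1 / 3\<close>.
  Strictness makes \<open>ln (ln 3)\<close>, and with it the denominator of the time bound,
  positive.\<close>

lemma ln_3_gt_1: "1 < ln (3 :: real)"
proof -
  have "7 / 8 \<le> exp (- 1 / 8 :: real)"
    using exp_ge_add_one_self[of "- 1 / 8 :: real"] by simp
  then have "(7 / 8) ^ 8 \<le> exp (- 1 / 8 :: real) ^ 8"
    by (intro power_mono) auto
  also have "\<dots> = exp (- 1)"
    by (simp flip: exp_of_nat_mult)
  finally have "1 / 3 < exp (- 1 :: real)"
    by (simp add: power_divide)
  then have "exp 1 < (3 :: real)"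
    by (simp add: exp_minus field_simps)
  then show ?thesis
    using ln_less_cancel_iff[of "exp 1" "3 :: real"] by simp
qed

text \<open>Telescoping: \<open>1 / (n + 2)\<close> is at most
  \<open>ln (n + 2) - ln (n + 1)\<close>.\<close>

lemma sum_inverse_le_ln: "(\<Sum>r = 1..n. 1 / (real r + 1)) \<le> ln (real n + 1)"
proof (induction n)
  case (Suc n)
  have "ln ((real n + 1) / (real n + 2)) \<le> (real n + 1) / (real n + 2) - 1"
    by (intro ln_le_minus_one) auto
  then have "1 / (real n + 2) \<le> ln (real n + 2) - ln (real n + 1)"
    by (simp add: ln_div field_simps)
  then show ?case
    using Suc by (simp add: algebra_simps)
qed simp

section \<open>The transmission probabilities of the protocol\<close>

lemma sublinear_decrease_le_half: "sublinear_decrease b r \<le> 1 / 2"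
proof -
  have "ln x / x \<le> 1 / 2" if "0 < x" for x :: real
    using ln_le_half[OF that] that by (simp add: field_simps)
  then show ?thesis
    unfolding sublinear_decrease_def Let_def by simp
qed

text \<open>The function \<open>ln x / x\<close> decreases from \<open>exp 1\<close> on, and the
  phases start at 3.\<close>

lemma antimono_sublinear_decrease: "antimono_on {1..} (sublinear_decrease b)"
proof (rule monotone_onI)
  fix r r' :: nat
  assume "r \<le> r'"
  have "exp 1 \<le> (3 :: real)"
    by (rule exp_le)
  then have "exp 1 \<le> real (3 + (r - 1) div b)"
    by simp
  moreover have "real (3 + (r - 1) div b) \<le> real (3 + (r' - 1) div b)"
    using \<open>r \<le> r'\<close> by (intro of_nat_mono add_left_mono div_le_mono diff_le_mono)
  ultimately show "sublinear_decrease b r' \<le> sublinear_decrease b r"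
    unfolding sublinear_decrease_def Let_def by (rule ln_div_antimono)
qed

text \<open>Round \<open>r\<close> lies in phase \<open>j\<close>, which means
  \<open>b * (j - 3) < r\<close> and \<open>r \<le> b * (j - 2)\<close>.\<close>

lemma phase_bounds:
  fixes b r :: nat
  assumes "1 \<le> b" "1 \<le> r"
  defines "j \<equiv> 3 + (r - 1) div b"
  shows "r + 2 * b \<le> b * j" "b * j < r + 3 * b"
proof -
  have "b * ((r - 1) div b) + (r - 1) mod b = r - 1" "(r - 1) mod b < b"
    using assms(1) by simp_all
  moreover have "b * j = 3 * b + b * ((r - 1) div b)"
    by (simp add: j_def algebra_simps)
  ultimately show "r + 2 * b \<le> b * j" "b * j < r + 3 * b"
    using assms(2) by linarith+
qed

text \<open>In round \<open>r\<close> the phase satisfies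
  \<open>(r + 1) / b \<le> j \<le> T + 2\<close>, so the sum is at most
  \<open>b * ln (T + 2)\<close> times a harmonic sum.\<close>

lemma sum_sublinear_decrease_le:
  assumes "1 \<le> b"
  shows "(\<Sum>r\<in>{1..T}. sublinear_decrease b r) \<le> real b * (ln (real T + 2))\<^sup>2"
proof -
  have "sublinear_decrease b r \<le> real b * ln (real T + 2) * (1 / (real r + 1))"
    if r: "r \<in> {1..T}" for r
  proof -
    define j where "j = 3 + (r - 1) div b"
    have "(r - 1) div b \<le> r - 1"
      by simp
    moreover have "1 \<le> r" "r \<le> T"
      using r by auto
    ultimately have "j \<le> T + 2" "0 < j"
      unfolding j_def by linarith+
    then have j: "0 < j" "real j \<le> real T + 2"
      by linarith+
    have "r + 2 * b \<le> b * j"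
      using phase_bounds(1) assms r by (auto simp: j_def)
    then have "r + 1 \<le> b * j"
      using assms by linarith
    then have "real r + 1 \<le> real b * real j"
      by (metis of_nat_1 of_nat_add of_nat_le_iff of_nat_mult)
    then have "1 / real j \<le> real b / (real r + 1)"
      using j by (simp add: field_simps)
    moreover have "ln (real j) \<le> ln (real T + 2)"
      using j by simp
    ultimately have "ln (real j) * (1 / real j) \<le> ln (real T + 2) * (real b / (real r + 1))"
      by (intro mult_mono) auto
    then show ?thesis
      by (simp add: sublinear_decrease_def Let_def j_def mult.commute)
  qed
  then have "(\<Sum>r\<in>{1..T}. sublinear_decrease b r) \<le>
      real b * ln (real T + 2) * (\<Sum>r\<in>{1..T}. 1 / (real r + 1))"
    unfolding sum_distrib_left by (intro sum_mono)
  also have "\<dots> \<le> real b * ln (real T + 2) * ln (real T + 2)"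
  proof (rule mult_left_mono)
    have "(\<Sum>r\<in>{1..T}. 1 / (real r + 1)) \<le> ln (real T + 1)"
      by (rule sum_inverse_le_ln)
    also have "\<dots> \<le> ln (real T + 2)"
      by simp
    finally show "(\<Sum>r\<in>{1..T}. 1 / (real r + 1)) \<le> ln (real T + 2)" .
  qed simp
  finally show ?thesis
    by (simp add: power2_eq_square)
qed

text \<open>The assumption on \<open>T\<close> forces the phase \<open>j\<close> of round
  \<open>T\<close> to be at least \<open>6 * k\<close>, whence \<open>ln j \<ge> ln k\<close>. It
  also gives \<open>b * j \<le> 2 * T\<close>, because the offset \<open>3 * b\<close> is at most
  half of \<open>b * j\<close>.\<close>

lemma sublinear_decrease_ge:
  assumes "1 \<le> b" "1 \<le> k" "6 * b * k \<le> T"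
  shows "real b * ln (real k) / 2 \<le> real T * sublinear_decrease b T"
proof -
  define j where "j = 3 + (T - 1) div b"
  have "1 \<le> 6 * b * k"
    using assms by simp
  then have T: "1 \<le> T"
    using assms by linarith
  have jT: "T + 2 * b \<le> b * j" "b * j < T + 3 * b"
    using phase_bounds[of b T] assms T by (auto simp: j_def)
  have "b * (6 * k) = 6 * b * k"
    by simp
  then have "b * (6 * k) \<le> b * j"
    using jT assms(3) by linarith
  then have j: "6 * k \<le> j"
    using assms(1) by simp
  then have "b * 6 \<le> b * j"
    using assms(2) by (intro mult_left_mono) auto
  then have "b * j \<le> 2 * T"
    using jT(2) by linarith
  then have bj: "real b * real j \<le> 2 * real T"
    by (metis of_nat_le_iff of_nat_mult of_nat_numeral)
  have "real b * real j * ln (real k) \<le> (2 * real T) * ln (real j)"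
    by (rule mult_mono) (use assms(2) j bj in auto)
  then have "real b * ln (real k) / 2 \<le> real T * (ln (real j) / real j)"
    using j assms(2) by (simp add: field_simps)
  then show ?thesis
    by (simp add: sublinear_decrease_def Let_def j_def)
qed

text \<open>The squared logarithm of a linear function of \<open>C\<close> is \<open>o(C)\<close>.
  This resolves the circularity that the window length, and so the logarithm in the load bound,
  depends on \<open>C\<close>.\<close>

lemma exists_constant:
  fixes b \<Lambda> c :: real
  assumes "0 < \<Lambda>"
  shows "\<exists>C\<ge>c. 16 * b * (3 + ln (C * \<Lambda> + 2))\<^sup>2 \<le> C"
proof -
  have "((\<lambda>C. 16 * b * (3 + ln (C * \<Lambda> + 2))\<^sup>2 / C) \<longlongrightarrow> 0) at_top"
    using assms by real_asymp
  then have "eventually (\<lambda>C. 16 * b * (3 + ln (C * \<Lambda> + 2))\<^sup>2 / C < 1) at_top"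
    by (rule order_tendstoD) simp
  moreover have "eventually (\<lambda>C. max 1 c \<le> C) at_top"
    by (rule eventually_ge_at_top)
  ultimately have "eventually (\<lambda>C. c \<le> C \<and> 16 * b * (3 + ln (C * \<Lambda> + 2))\<^sup>2 \<le> C) at_top"
    by eventually_elim (auto simp: field_simps)
  then show ?thesis
    using eventually_happens' by force
qed

theorem theorem5p2:
  fixes \<eta> :: real
  assumes "\<eta> > 0"
  shows "\<exists>b0 :: nat. \<forall>b \<ge> b0. \<exists>C :: real. \<forall>k \<ge> (3 :: nat). \<forall>adv :: adversary.
    (AE \<omega> in coin_space k (sublinear_decrease b). \<forall>i < k. \<exists>s. activated_at k adv \<omega> s i) \<longrightarrow>
    measure (coin_space k (sublinear_decrease b))
      {\<omega> \<in> space (coin_space k (sublinear_decrease b)).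
        \<forall>i < k. \<exists>s r. activated_at k adv \<omega> s i \<and> succeeds_at k adv \<omega> (s + r) i \<and>
          real r \<le> C * real k * (ln (real k))\<^sup>2 / ln (ln (real k))}
    \<ge> 1 - 1 / real k powr \<eta>"
proof (intro exI[of _ "nat \<lceil>8 * exp 2 * (\<eta> + 2)\<rceil>"] allI impI)
  fix b :: nat
  assume b_ge: "b \<ge> nat \<lceil>8 * exp 2 * (\<eta> + 2)\<rceil>"
  \<comment> \<open>The threshold is what rounds of low load require:
    \<open>T * p T \<ge> b * ln k / 2\<close> has to imply
    \<open>p T * exp (- 2) * T / 4 \<ge> (\<eta> + 2) * ln k\<close>.\<close>
  then have b: "8 * exp 2 * (\<eta> + 2) \<le> real b"
    by linarith
  have "0 < 8 * exp 2 * (\<eta> + 2)"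
    using assms by simp
  then have b1: "1 \<le> b"
    using b by linarith
  \<comment> \<open>A bound on \<open>1 / ln (ln k)\<close> that is uniform in
    \<open>k \<ge> 3\<close>.\<close>
  define \<Lambda> where "\<Lambda> = 1 / ln (ln (3 :: real))"
  have \<Lambda>: "0 < \<Lambda>"
    using ln_3_gt_1 by (simp add: \<Lambda>_def)
  \<comment> \<open>The bound \<open>12 * b\<close> makes the window at least
    \<open>6 * b * k\<close> rounds long, the second one serves rounds of high load, and
    \<open>C_ln\<close> keeps the average load small.\<close>
  obtain C where C_ge: "max (12 * b) (16 * exp 2 * (\<eta> + 2)) \<le> C"
    and C_ln: "16 * real b * (3 + ln (C * \<Lambda> + 2))\<^sup>2 \<le> C"
    using exists_constant[OF \<Lambda>] by metis
  have C: "12 * b \<le> C" "16 * exp 2 * (\<eta> + 2) \<le> C"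
    using C_ge by auto
  have C_pos: "0 < C"
    using C(1) b1 by linarith
  show "\<exists>C. \<forall>k\<ge>3. \<forall>adv :: adversary.
    (AE \<omega> in coin_space k (sublinear_decrease b). \<forall>i < k. \<exists>s. activated_at k adv \<omega> s i) \<longrightarrow>
    measure (coin_space k (sublinear_decrease b))
      {\<omega> \<in> space (coin_space k (sublinear_decrease b)).
        \<forall>i < k. \<exists>s r. activated_at k adv \<omega> s i \<and> succeeds_at k adv \<omega> (s + r) i \<and>
          real r \<le> C * real k * (ln (real k))\<^sup>2 / ln (ln (real k))}
    \<ge> 1 - 1 / real k powr \<eta>"
  proof (intro exI[of _ C] allI impI)
    fix k :: nat and adv :: adversary
    assume k: "3 \<le> k" and act: "AE \<omega> in coin_space k (sublinear_decrease b).
      \<forall>i < k. \<exists>s. activated_at k adv \<omega> s i"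
    interpret channel k adv "sublinear_decrease b"
      by unfold_locales (rule sublinear_decrease_bounds)+
    have C\<Lambda>: "0 < C * \<Lambda>"
      using C_pos \<Lambda> by simp
    define L where "L = ln (real k)"
    define LL where "LL = ln L"
    have "ln 3 \<le> L"
      using k by (simp add: L_def)
    then have L: "1 < L"
      using ln_3_gt_1 by simp
    have "ln (ln 3) \<le> LL"
      using \<open>ln 3 \<le> L\<close> ln_3_gt_1 L by (simp add: LL_def)
    moreover have "0 < ln (ln (3 :: real))"
      using ln_3_gt_1 by simp
    ultimately have LL: "0 < LL" "1 / LL \<le> \<Lambda>"
      unfolding \<Lambda>_def by (linarith, intro divide_left_mono mult_pos_pos) linarith+
    have L_le_k: "L \<le> k"
      using ln_le_minus_one[of "real k"] k by (simp add: L_def)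
    have LL_le: "LL \<le> L"
      using ln_le_minus_one[of L] L by (simp add: LL_def)
    have LL_sqrt: "LL \<le> 2 * sqrt L"
      using ln_le_minus_one[of "sqrt L"] L by (simp add: LL_def ln_sqrt)

    \<comment> \<open>The window \<open>T\<close> is the claimed time bound, rounded down. The
      choice of \<open>\<theta>\<close> makes \<open>exp (- 2 * \<theta>)\<close> equal to
      \<open>exp (- 2) / sqrt L\<close>, and that of \<open>a\<close> makes
      \<open>k * exp (- a)\<close> equal to \<open>1 / k powr \<eta>\<close>.\<close>
    define X where "X = C * real k * L\<^sup>2 / LL"
    define T where "T = nat \<lfloor>X\<rfloor>"
    define \<theta> where "\<theta> = 1 + LL / 4"
    define m where "m = min (sublinear_decrease b T * exp (- 2)) (exp (- 2 * \<theta>) / k)"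
    define a where "a = (\<eta> + 1) * L"

    have "LL \<le> L\<^sup>2"
      using LL_le L self_le_power[of L 2] by simp
    then have "real (12 * b) * real k * 1 \<le> C * k * (L\<^sup>2 / LL)"
      using C(1) C_pos LL by (intro mult_mono) auto
    then have X: "12 * b * k \<le> X"
      by (simp add: X_def)
    have "1 \<le> 6 * b * k"
      using b1 k by simp
    then have "2 \<le> X"
      using X by linarith
    then have T: "X / 2 \<le> T" "T \<le> X"
      unfolding T_def by linarith+
    have T6: "6 * b * k \<le> T"
      using T X by linarith

    \<comment> \<open>A crude polynomial bound on \<open>T\<close> suffices: it makes
      \<open>ln (T + 2)\<close> at most a constant times \<open>L\<close>.\<close>
    have "L\<^sup>2 \<le> (real k)\<^sup>2"
      using L_le_k L by (intro power_mono) auto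
    then have "L\<^sup>2 * (1 / LL) \<le> (real k)\<^sup>2 * \<Lambda>"
      using LL by (intro mult_mono) auto
    then have "C * k * (L\<^sup>2 * (1 / LL)) \<le> C * k * ((real k)\<^sup>2 * \<Lambda>)"
      using C_pos by (intro mult_left_mono) auto
    then have "X \<le> C * k * ((real k)\<^sup>2 * \<Lambda>)"
      by (simp add: X_def)
    also have "\<dots> = real k ^ 3 * (C * \<Lambda>)"
      by (simp add: power2_eq_square power3_eq_cube)
    finally have "T + 2 \<le> real k ^ 3 * (C * \<Lambda>) + 1 * 2"
      using T by simp
    also have "\<dots> \<le> real k ^ 3 * (C * \<Lambda>) + real k ^ 3 * 2"
      using k by (intro add_left_mono mult_right_mono) auto
    finally have "T + 2 \<le> real k ^ 3 * (C * \<Lambda> + 2)"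
      by (simp add: algebra_simps)
    then have "ln (real T + 2) \<le> ln (real k ^ 3 * (C * \<Lambda> + 2))"
      using k C\<Lambda> by (subst ln_le_cancel_iff) (auto intro!: mult_pos_pos add_pos_pos)
    also have "\<dots> = 3 * L + ln (C * \<Lambda> + 2)"
      using k C\<Lambda> by (subst ln_mult) (auto simp: L_def ln_realpow)
    also have "\<dots> \<le> L * (3 + ln (C * \<Lambda> + 2))"
      using L C\<Lambda> mult_right_mono[of 1 L "ln (C * \<Lambda> + 2)"] by (simp add: algebra_simps)
    finally have "(ln (real T + 2))\<^sup>2 \<le> (L * (3 + ln (C * \<Lambda> + 2)))\<^sup>2"
      by (intro power_mono) auto
    then have "16 * real b * (ln (real T + 2))\<^sup>2 \<le>
        16 * real b * (L * (3 + ln (C * \<Lambda> + 2)))\<^sup>2"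
      by (intro mult_left_mono) auto
    also have "\<dots> = L\<^sup>2 * (16 * real b * (3 + ln (C * \<Lambda> + 2))\<^sup>2)"
      by (simp add: power_mult_distrib)
    also have "\<dots> \<le> L\<^sup>2 * C"
      using C_ln by (intro mult_left_mono) auto
    finally have lnT: "16 * real b * (ln (real T + 2))\<^sup>2 \<le> L\<^sup>2 * C" .

    have load: "2 * k * (\<Sum>r\<in>{1..T}. sublinear_decrease b r) \<le> \<theta> * T"
    proof -
      have "2 * k * (\<Sum>r\<in>{1..T}. sublinear_decrease b r) \<le> 2 * k * (b * (ln (real T + 2))\<^sup>2)"
        using b1 by (intro mult_left_mono sum_sublinear_decrease_le) auto
      also have "\<dots> = k / 8 * (16 * real b * (ln (real T + 2))\<^sup>2)"
        by simp
      also have "\<dots> \<le> k / 8 * (L\<^sup>2 * C)"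
        using lnT by (intro mult_left_mono) auto
      also have "\<dots> = (LL / 4) * (X / 2)"
        using LL by (simp add: X_def)
      also have "\<dots> \<le> \<theta> * T"
        using T LL \<open>2 \<le> X\<close> by (intro mult_mono) (auto simp: \<theta>_def)
      finally show ?thesis .
    qed

    have "a + 1 \<le> (\<eta> + 2) * L"
      using L by (simp add: a_def algebra_simps)
    \<comment> \<open>Rounds of load at most 1, paid for by the size of \<open>b\<close>.\<close>
    moreover have "(\<eta> + 2) * L \<le> (sublinear_decrease b T * exp (- 2)) * T / 4"
    proof -
      have "8 * exp 2 * (\<eta> + 2) * L \<le> b * L"
        using b L by (intro mult_right_mono) auto
      then have "(\<eta> + 2) * L \<le> exp (- 2) / 4 * (b * L / 2)"
        by (simp add: exp_minus field_simps)
      also have "\<dots> \<le> exp (- 2) / 4 * (T * sublinear_decrease b T)"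
        unfolding L_def using b1 k T6 by (intro mult_left_mono sublinear_decrease_ge) auto
      finally show ?thesis
        by (simp add: mult_ac)
    qed
    \<comment> \<open>Rounds of load above 1, paid for by the size of \<open>C\<close>. As
      \<open>X / k\<close> is \<open>C * L\<^sup>2 / LL\<close>, the loss of
      \<open>sqrt L * LL\<close> has to be at most of order \<open>L\<close>, which
      \<open>LL \<le> 2 * sqrt L\<close> provides.\<close>
    moreover have "(\<eta> + 2) * L \<le> exp (- 2 * \<theta>) / k * T / 4"
    proof -
      have "exp (- 2 * \<theta>) = exp (- 2) * exp (- (LL / 2))"
        by (simp add: \<theta>_def flip: exp_add)
      also have "LL / 2 = ln (sqrt L)"
        using L by (simp add: LL_def ln_sqrt)
      also have "exp (- 2) * exp (- ln (sqrt L)) = 1 / (exp 2 * sqrt L)"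
        using L by (simp add: exp_minus field_simps)
      finally have e: "exp (- 2 * \<theta>) = 1 / (exp 2 * sqrt L)" .
      have "16 * exp 2 * (\<eta> + 2) * L \<le> C * L"
        using C(2) L by (intro mult_right_mono) auto
      then have "(\<eta> + 2) * L \<le> C * L / (16 * exp 2)"
        by (simp add: field_simps)
      also have "\<dots> = C * L\<^sup>2 / (8 * exp 2 * sqrt L * (2 * sqrt L))"
        using L by (simp add: power2_eq_square)
      also have "\<dots> \<le> C * L\<^sup>2 / (8 * exp 2 * sqrt L * LL)"
        using L LL LL_sqrt C_pos by (intro divide_left_mono mult_left_mono) auto
      also have "\<dots> = 1 / (exp 2 * sqrt L) / k * (X / 2) / 4"
        using k by (simp add: X_def)
      also have "\<dots> \<le> exp (- 2 * \<theta>) / k * T / 4"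
        unfolding e using T L by (intro divide_right_mono mult_left_mono) auto
      finally show ?thesis .
    qed
    ultimately have "a + 1 \<le> m * T / 4"
      unfolding m_def min_def by auto
    then have "1 - k * exp (- a) \<le> prob {\<omega> \<in> space (coin_space k (sublinear_decrease b)).
        \<forall>i<k. \<exists>s r. activated_at k adv \<omega> s i \<and> succeeds_at k adv \<omega> (s + r) i \<and> real r \<le> X}"
      using k act T LL
      by (intro prob_all_succeed_ge[where T = T and \<theta> = \<theta> and m = m,
            OF _ antimono_sublinear_decrease sublinear_decrease_le_half _ load])
        (auto simp: m_def \<theta>_def sublinear_decrease_bounds)
    moreover have "k * exp (- a) = 1 / real k powr \<eta>"
    proof -
      have "exp (- a) = real k powr (- (\<eta> + 1))"
        using k by (simp add: a_def L_def powr_def algebra_simps)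
      also have "\<dots> = 1 / (real k powr \<eta> * k)"
        using k by (subst powr_minus) (simp add: powr_add divide_inverse)
      finally show ?thesis
        using k by simp
    qed
    ultimately show "1 - 1 / real k powr \<eta> \<le>
      measure (coin_space k (sublinear_decrease b))
      {\<omega> \<in> space (coin_space k (sublinear_decrease b)).
        \<forall>i < k. \<exists>s r. activated_at k adv \<omega> s i \<and> succeeds_at k adv \<omega> (s + r) i \<and>
          real r \<le> C * real k * (ln (real k))\<^sup>2 / ln (ln (real k))}"
      by (simp add: X_def L_def LL_def)
  qed
qed

end
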